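(* Let $\mathcal{D}_x\subseteq\mathbb{R}^{N_x}$, let $\mathcal{D}_\theta\subseteq\mathbb{R}^{N_\theta}$ be a compact set, and let $\bm{\theta}\in\mathcal{D}_\theta$ be a vector of $N_\theta$ environmental parameters, which is a realization of continuous random variables with probability density function $p(\bm{\theta})$. Let $f(\bm{x};\bm{\theta})$ and $C_i(\bm{x};\bm{\theta})$, $i=1,\dots,I$, be differentiable with respect to $\bm{x}$ and $\bm{\theta}$. For a given realization $\bm{\theta}\in\mathcal{D}_\theta$ consider the variable optimization problem $$(\mathrm{V}_{\bm{\theta}})\qquad \min_{\bm{x}} f(\bm{x};\bm{\theta})\quad\text{s.t.}\quad C_i(\bm{x};\bm{\theta})\le 0,\ i=1,\dots,I,$$ where $\bm{x}\in\mathcal{D}_x$ (this constraint is regarded as a special case of the constraints $C_i\le 0$ and is not listed explicitly), and consider the functional optimization problem, in which the function $\bm{x}(\bm{\theta})$ is optimized, $$(\mathrm{F})\qquad \min_{\bm{x}(\bm{\theta})} \mathbb{E}_{\bm{\theta}}\{f[\bm{x}(\bm{\theta});\bm{\theta}]\}=\int_{\bm{\theta}\in\mathcal{D}_\theta} f[\bm{x}(\bm{\theta});\bm{\theta}]\,p(\bm{\theta})\,\mathrm{d}\bm{\theta}\quad\text{s.t.}\quad C_i[\bm{x}(\bm{\theta});\bm{\theta}]\le 0,\ \forall \bm{\theta}\in\mathcal{D}_\theta,\ i=1,\dots,I.$$ Let $\bm{x}^*(\bm{\theta})$ denote the mapping from $\bm{\theta}$ to the optimal solution of $(\mathrm{V}_{\bm{\theta}})$,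 and let $\bm{x}_{\rm opt}(\bm{\theta})$ denote the optimal solution of $(\mathrm{F})$. Then $\bm{x}^*(\bm{\theta})$ is optimal for problem $(\mathrm{F})$, and the value of $\bm{x}_{\rm opt}(\bm{\theta})$ given an arbitrary realization of $\bm{\theta}$ is optimal for problem $(\mathrm{V}_{\bm{\theta}})$ with probability one.
   Context: $\mathbb{E}_{\bm{\theta}}$ denotes expectation over $\bm{\theta}$ with density $p$, and "with probability one" refers to the distribution of $\bm{\theta}$. The problem $(\mathrm{V}_{\bm{\theta}})$ is solved separately for each realization of $\bm{\theta}$, whereas the constraints in $(\mathrm{F})$ must hold for all $\bm{\theta}\in\mathcal{D}_\theta$.
   Formalization: The expectation of f[x*(θ);θ] is additionally assumed to exist and be finite, and candidates in (F) are the feasible functions whose objective integral exists and is finite; without this the second claim can fail. *)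

theory Defs
  imports "HOL-Probability.Probability"
begin

definition V_feasible ::
  "(real^'nx) set \<Rightarrow> nat \<Rightarrow> (nat \<Rightarrow> real^'nx \<Rightarrow> real^'nt \<Rightarrow> real) \<Rightarrow> real^'nt \<Rightarrow> real^'nx \<Rightarrow> bool"
where
  "V_feasible Dx I C \<theta> x \<longleftrightarrow> x \<in> Dx \<and> (\<forall>i\<in>{1..I}. C i x \<theta> \<le> 0)"

definition V_optimal ::
  "(real^'nx) set \<Rightarrow> nat \<Rightarrow> (real^'nx \<Rightarrow> real^'nt \<Rightarrow> real) \<Rightarrow> (nat \<Rightarrow> real^'nx \<Rightarrow> real^'nt \<Rightarrow> real)
    \<Rightarrow> real^'nt \<Rightarrow> real^'nx \<Rightarrow> bool"
where
  "V_optimal Dx I f C \<theta> = is_arg_min (\<lambda>x. f x \<theta>) (V_feasible Dx I C \<theta>)"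

text \<open>The Bochner integral is \<open>0\<close> for non-integrable functions, so \<open>F_objective\<close> is meaningful only
  together with \<open>F_objective_exists\<close>, which says that the expectation exists and is finite.\<close>

definition F_objective_exists ::
  "(real^'nt) set \<Rightarrow> (real^'nt \<Rightarrow> real) \<Rightarrow> (real^'nx \<Rightarrow> real^'nt \<Rightarrow> real) \<Rightarrow> (real^'nt \<Rightarrow> real^'nx) \<Rightarrow> bool"
where
  "F_objective_exists D\<theta> p f x \<longleftrightarrow> set_integrable lborel D\<theta> (\<lambda>\<theta>. f (x \<theta>) \<theta> * p \<theta>)"

definition F_objective ::
  "(real^'nt) set \<Rightarrow> (real^'nt \<Rightarrow> real) \<Rightarrow> (real^'nx \<Rightarrow> real^'nt \<Rightarrow> real) \<Rightarrow> (real^'nt \<Rightarrow> real^'nx) \<Rightarrow> real"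
where
  "F_objective D\<theta> p f x = set_lebesgue_integral lborel D\<theta> (\<lambda>\<theta>. f (x \<theta>) \<theta> * p \<theta>)"

text \<open>The candidates are all functions satisfying the constraints for which the objective is defined;
  no measurability of \<open>x\<close> itself is required. Values of \<open>x\<close> outside \<open>D\<theta>\<close> are irrelevant.\<close>

definition F_feasible ::
  "(real^'nx) set \<Rightarrow> (real^'nt) set \<Rightarrow> (real^'nt \<Rightarrow> real) \<Rightarrow> nat \<Rightarrow> (real^'nx \<Rightarrow> real^'nt \<Rightarrow> real)
    \<Rightarrow> (nat \<Rightarrow> real^'nx \<Rightarrow> real^'nt \<Rightarrow> real) \<Rightarrow> (real^'nt \<Rightarrow> real^'nx) \<Rightarrow> bool"
where
  "F_feasible Dx D\<theta> p I f C x \<longleftrightarrow>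
     F_objective_exists D\<theta> p f x \<and>
     (\<forall>\<theta>\<in>D\<theta>. x \<theta> \<in> Dx \<and> (\<forall>i\<in>{1..I}. C i (x \<theta>) \<theta> \<le> 0))"

definition F_optimal ::
  "(real^'nx) set \<Rightarrow> (real^'nt) set \<Rightarrow> (real^'nt \<Rightarrow> real) \<Rightarrow> nat \<Rightarrow> (real^'nx \<Rightarrow> real^'nt \<Rightarrow> real)
    \<Rightarrow> (nat \<Rightarrow> real^'nx \<Rightarrow> real^'nt \<Rightarrow> real) \<Rightarrow> (real^'nt \<Rightarrow> real^'nx) \<Rightarrow> bool"
where
  "F_optimal Dx D\<theta> p I f C = is_arg_min (F_objective D\<theta> p f) (F_feasible Dx D\<theta> p I f C)"

end

theory Submission
  imports Defs
begin

text \<open>Pointwise optimality of \<open>xstar\<close> makes the integrand of any feasible \<open>x\<close> dominate that of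
  \<open>xstar\<close> on \<open>D\<theta>\<close>, so \<open>xstar\<close> minimises the integral. If \<open>x\<close> attains the same integral, the
  nonnegative difference of the integrands has integral zero and hence vanishes almost everywhere;
  where \<open>p\<close> is positive, this forces the two objective values to agree.\<close>

lemma V_optimal_le:
  assumes "V_optimal Dx I f C \<theta> x" and "V_feasible Dx I C \<theta> y"
  shows "f x \<theta> \<le> f y \<theta>"
  using assms by (auto simp: V_optimal_def is_arg_min_def not_less)

lemma V_optimal_cong:
  assumes "V_optimal Dx I f C \<theta> x" and "V_feasible Dx I C \<theta> y" and "f y \<theta> = f x \<theta>"
  shows "V_optimal Dx I f C \<theta> y"
  using assms by (auto simp: V_optimal_def is_arg_min_def)

text \<open>Apart from integrability, the constraints never link two values of \<theta>; this
  decoupling is what allows comparison of candidates point by point.\<close>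

lemma F_feasible_iff:
  "F_feasible Dx D\<theta> p I f C x \<longleftrightarrow>
     F_objective_exists D\<theta> p f x \<and> (\<forall>\<theta>\<in>D\<theta>. V_feasible Dx I C \<theta> (x \<theta>))"
  by (simp add: F_feasible_def V_feasible_def)

text \<open>Monotonicity of the Bochner integral needs both integrands integrable: \<open>ex\<close>
  supplies this for \<open>x\<close>, and feasibility supplies it for each competitor.
  \<open>ex\<close> also makes \<open>x\<close> itself a candidate.\<close>

lemma F_optimal_of_pointwise:
  assumes p: "\<And>\<theta>. 0 \<le> p \<theta>"
    and opt: "\<And>\<theta>. \<theta> \<in> D\<theta> \<Longrightarrow> V_optimal Dx I f C \<theta> (x \<theta>)"
    and ex: "F_objective_exists D\<theta> p f x"
  shows "F_optimal Dx D\<theta> p I f C x"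
proof -
  have "F_objective D\<theta> p f x \<le> F_objective D\<theta> p f y" if y: "F_feasible Dx D\<theta> p I f C y" for y
    unfolding F_objective_def
  proof (rule set_integral_mono)
    show "set_integrable lborel D\<theta> (\<lambda>\<theta>. f (x \<theta>) \<theta> * p \<theta>)"
      using ex by (simp add: F_objective_exists_def)
    show "set_integrable lborel D\<theta> (\<lambda>\<theta>. f (y \<theta>) \<theta> * p \<theta>)"
      using y by (simp add: F_feasible_iff F_objective_exists_def)
    show "f (x \<theta>) \<theta> * p \<theta> \<le> f (y \<theta>) \<theta> * p \<theta>" if "\<theta> \<in> D\<theta>" for \<theta>
      using V_optimal_le[OF opt[OF that]] y that p
      by (auto simp: F_feasible_iff intro!: mult_right_mono)
  qed
  moreover have "F_feasible Dx D\<theta> p I f C x"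
    using ex opt by (auto simp: F_feasible_iff V_optimal_def is_arg_min_def)
  ultimately show ?thesis
    by (auto simp: F_optimal_def is_arg_min_def not_less)
qed

text \<open>The guard \<open>0 < p \<theta>\<close> appears because the weighted integrand carries
  no information about \<open>y \<theta>\<close> where the density vanishes. It is also the form in
  which almost-everywhere statements pass to a measure with density \<open>p\<close>.\<close>

lemma F_optimal_imp_AE_V_optimal:
  assumes p: "\<And>\<theta>. 0 \<le> p \<theta>"
    and opt: "\<And>\<theta>. \<theta> \<in> D\<theta> \<Longrightarrow> V_optimal Dx I f C \<theta> (x \<theta>)"
    and ex: "F_objective_exists D\<theta> p f x"
    and y: "F_optimal Dx D\<theta> p I f C y"
  shows "AE \<theta> in lborel. \<theta> \<in> D\<theta> \<longrightarrow> 0 < p \<theta> \<longrightarrow> V_optimal Dx I f C \<theta> (y \<theta>)"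
proof -
  \<comment> \<open>The indicators extend both integrands by zero, so \<open>d\<close> lives on the
    whole space and its integral is the difference of the two objectives.\<close>
  define d where "d = (\<lambda>\<theta>. indicator D\<theta> \<theta> *\<^sub>R (f (y \<theta>) \<theta> * p \<theta>) - indicator D\<theta> \<theta> *\<^sub>R (f (x \<theta>) \<theta> * p \<theta>))"
  have yf: "F_feasible Dx D\<theta> p I f C y"
    using y by (simp add: F_optimal_def is_arg_min_def)
  have ix: "integrable lborel (\<lambda>\<theta>. indicator D\<theta> \<theta> *\<^sub>R (f (x \<theta>) \<theta> * p \<theta>))"
    using ex by (simp add: F_objective_exists_def set_integrable_def)
  have iy: "integrable lborel (\<lambda>\<theta>. indicator D\<theta> \<theta> *\<^sub>R (f (y \<theta>) \<theta> * p \<theta>))"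
    using yf by (simp add: F_feasible_iff F_objective_exists_def set_integrable_def)
  \<comment> \<open>Both functions minimise the same objective, so each value bounds the
    other.\<close>
  have "F_objective D\<theta> p f x = F_objective D\<theta> p f y"
    using F_optimal_of_pointwise[OF p opt ex] y
    by (auto simp: F_optimal_def is_arg_min_def intro: antisym leI)
  then have "integral\<^sup>L lborel d = 0"
    using ix iy by (simp add: d_def F_objective_def set_lebesgue_integral_def)
  moreover have "integrable lborel d"
    unfolding d_def by (intro Bochner_Integration.integrable_diff ix iy)
  \<comment> \<open>Outside \<open>D\<theta>\<close> both terms are zero; inside,
    \<open>y \<theta>\<close> is a feasible competitor of the minimiser
    \<open>x \<theta>\<close>.\<close>
  moreover have "0 \<le> d \<theta>" for \<theta>
    using V_optimal_le[OF opt] yf p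
    by (auto simp: d_def F_feasible_iff indicator_def intro!: mult_right_mono)
  ultimately have "AE \<theta> in lborel. d \<theta> = 0"
    by (simp add: integral_nonneg_eq_0_iff_AE)
  then show ?thesis
  proof eventually_elim
    case (elim \<theta>)
    then show ?case
      \<comment> \<open>On \<open>D\<theta>\<close>, \<open>d \<theta> = 0\<close> equates the two
        weighted values, and the factor \<open>p \<theta> > 0\<close> cancels.\<close>
      using V_optimal_cong[OF opt, of \<theta> "y \<theta>"] yf by (auto simp: d_def F_feasible_iff)
  qed
qed

theorem proposition1:
  fixes M :: "'w measure"
    and \<Theta> :: "'w \<Rightarrow> real^'nt"
    and p :: "real^'nt \<Rightarrow> real"
    and Dx :: "(real^'nx) set"
    and D\<theta> :: "(real^'nt) set"
    and f :: "real^'nx \<Rightarrow> real^'nt \<Rightarrow> real"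
    and C :: "nat \<Rightarrow> real^'nx \<Rightarrow> real^'nt \<Rightarrow> real"
    and I :: nat
    and xstar :: "real^'nt \<Rightarrow> real^'nx"
  assumes "prob_space M"
    and "compact D\<theta>"
    and "\<And>\<theta>. 0 \<le> p \<theta>"
    and "distributed M lborel \<Theta> (\<lambda>\<theta>. ennreal (p \<theta>))"
    and "AE \<omega> in M. \<Theta> \<omega> \<in> D\<theta>"
    and "\<And>\<theta>. \<theta> \<in> D\<theta> \<Longrightarrow> (\<lambda>x. f x \<theta>) differentiable_on Dx"
    and "\<And>x. x \<in> Dx \<Longrightarrow> (\<lambda>\<theta>. f x \<theta>) differentiable_on D\<theta>"
    and "\<And>i \<theta>. i \<in> {1..I} \<Longrightarrow> \<theta> \<in> D\<theta> \<Longrightarrow> (\<lambda>x. C i x \<theta>) differentiable_on Dx"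
    and "\<And>i x. i \<in> {1..I} \<Longrightarrow> x \<in> Dx \<Longrightarrow> (\<lambda>\<theta>. C i x \<theta>) differentiable_on D\<theta>"
    and "\<And>\<theta>. \<theta> \<in> D\<theta> \<Longrightarrow> V_optimal Dx I f C \<theta> (xstar \<theta>)"
    and "F_objective_exists D\<theta> p f xstar"
  shows "F_optimal Dx D\<theta> p I f C xstar \<and>
    (\<forall>xopt. F_optimal Dx D\<theta> p I f C xopt \<longrightarrow>
       (AE \<theta> in distr M lborel \<Theta>. V_optimal Dx I f C \<theta> (xopt \<theta>)))"
proof (intro conjI allI impI)
  show "F_optimal Dx D\<theta> p I f C xstar"
    by (rule F_optimal_of_pointwise) (use assms in auto)
next
  fix xopt
  assume y: "F_optimal Dx D\<theta> p I f C xopt"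
  have distr: "distr M lborel \<Theta> = density lborel (\<lambda>\<theta>. ennreal (p \<theta>))"
    and meas: "(\<lambda>\<theta>. ennreal (p \<theta>)) \<in> borel_measurable lborel"
    and \<Theta>: "\<Theta> \<in> measurable M lborel"
    using assms(4) by (simp_all add: distributed_def)
  \<comment> \<open>Compactness gives measurability, under which the almost sure event can be
    transported along \<Theta> to its distribution.\<close>
  have "D\<theta> \<in> sets lborel"
    using assms(2) by (simp add: compact_imp_closed)
  then have "AE \<theta> in distr M lborel \<Theta>. \<theta> \<in> D\<theta>"
    using assms(5) \<Theta> by (subst AE_distr_iff) auto
  moreover have "AE \<theta> in lborel. \<theta> \<in> D\<theta> \<longrightarrow> 0 < p \<theta> \<longrightarrow> V_optimal Dx I f C \<theta> (xopt \<theta>)"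
    by (rule F_optimal_imp_AE_V_optimal[where x = xstar]) (use assms y in auto)
  then have "AE \<theta> in distr M lborel \<Theta>. \<theta> \<in> D\<theta> \<longrightarrow> V_optimal Dx I f C \<theta> (xopt \<theta>)"
    \<comment> \<open>Almost everywhere for the density measure means Lebesgue-almost everywhere
      where \<open>ennreal (p \<theta>)\<close> is positive, which is the guard above.\<close>
    unfolding distr AE_density[OF meas] by eventually_elim auto
  ultimately show "AE \<theta> in distr M lborel \<Theta>. V_optimal Dx I f C \<theta> (xopt \<theta>)"
    by eventually_elim auto
qed

end
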